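(* Let $\mathbf{u}$ be a uniformly recurrent infinite word over a finite alphabet $\mathcal{A}$ with $\#\mathcal{A}=k$, and assume that the factor complexity of $\mathbf{u}$ satisfies $\mathcal{C}(n)=(k-1)n+1$ for all $n\in\mathbb{N}$. If every palindrome in $\mathcal{L}(\mathbf{u})$ has a unique palindromic extension in $\mathbf{u}$, then every factor of $\mathbf{u}$ has exactly $k$ return words.
   Context: An infinite word over a finite alphabet $\mathcal{A}$ is a one-sided infinite sequence $\mathbf{u}=u_0u_1u_2\ldots$ of letters of $\mathcal{A}$ in which every letter of $\mathcal{A}$ occurs. Its language $\mathcal{L}(\mathbf{u})$ is the set of all its finite factors (contiguous subwords), including the empty word; $\mathcal{C}(n)$ is the number of distinct factors of length $n$; $\mathbb{N}$ includes $0$. An occurrence of a factor $w$ is an index $i$ such that $w$ is a prefix of $u_iu_{i+1}u_{i+2}\ldots$. $\mathbf{u}$ is recurrent if every factor has at least two (equivalently infinitely many) occurrences, and uniformly recurrent if, moreover, for every factor $w$ the distances between successive occurrences of $w$ are bounded. If $i<j$ are two successive occurrences of $w$ in $\mathbf{u}$, the word $u_iu_{i+1}\cdots u_{j-1}$ is a return word of $w$; the return words of $w$ are counted as distinct words. A word is a palindrome if it equals its reversal (the empty word is a palindrome). For a palindrome $w\in\mathcal{L}(\mathbf{u})$, a palindromic extension of $w$ is a word $awa\in\mathcal{L}(\mathbf{u})$ with $a\in\mathcal{A}$. *)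

theory Defs
  imports "HOL-Library.Omega_Words_Fun"
begin

definition infinite_word_over :: "'a set \<Rightarrow> 'a word \<Rightarrow> bool" where
  "infinite_word_over A u \<longleftrightarrow> finite A \<and> range u = A"

definition language :: "'a word \<Rightarrow> 'a list set" where
  "language u = {u [i \<rightarrow> j] | i j. i \<le> j}"

definition factor_complexity :: "'a word \<Rightarrow> nat \<Rightarrow> nat" where
  "factor_complexity u n = card {w \<in> language u. length w = n}"

definition occurrence :: "'a word \<Rightarrow> 'a list \<Rightarrow> nat \<Rightarrow> bool" where
  "occurrence u w i \<longleftrightarrow> prefix (length w) (suffix i u) = w"

definition successive_occurrences :: "'a word \<Rightarrow> 'a list \<Rightarrow> nat \<Rightarrow> nat \<Rightarrow> bool" where
  "successive_occurrences u w i j \<longleftrightarrow>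
     i < j \<and> occurrence u w i \<and> occurrence u w j \<and>
     (\<forall>m. i < m \<and> m < j \<longrightarrow> \<not> occurrence u w m)"

definition recurrent :: "'a word \<Rightarrow> bool" where
  "recurrent u \<longleftrightarrow>
     (\<forall>w \<in> language u. \<exists>i j. i \<noteq> j \<and> occurrence u w i \<and> occurrence u w j)"

definition uniformly_recurrent :: "'a word \<Rightarrow> bool" where
  "uniformly_recurrent u \<longleftrightarrow>
     recurrent u \<and>
     (\<forall>w \<in> language u. \<exists>B. \<forall>i j. successive_occurrences u w i j \<longrightarrow> j - i \<le> B)"

definition return_words :: "'a word \<Rightarrow> 'a list \<Rightarrow> 'a list set" where
  "return_words u w = {u [i \<rightarrow> j] | i j. successive_occurrences u w i j}"

definition palindrome :: "'a list \<Rightarrow> bool" where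
  "palindrome w \<longleftrightarrow> rev w = w"

definition palindromic_extension :: "'a word \<Rightarrow> 'a list \<Rightarrow> 'a list \<Rightarrow> bool" where
  "palindromic_extension u w v \<longleftrightarrow> v \<in> language u \<and> (\<exists>a. v = [a] @ w @ [a])"

end

theory Submission
  imports Defs
begin

text \<open>
  Uniform recurrence and the existence of arbitrarily long palindromes make the language closed
  under reversal. Consider the graph whose vertices are the factors of length \<open>n\<close> and whose
  edges are the non-palindromic factors of length \<open>n + 1\<close>, both taken up to reversal. It is
  connected, and since there are \<open>k + 1\<close> palindromes of length \<open>n\<close> or \<open>n + 1\<close>, it has one edge
  less than vertices, so it is a tree. The two-sided extensions of a factor \<open>v\<close> form a subgraph of
  such a tree, which gives \<open>e(v) \<le> l(v) + r(v) - 1\<close> for the numbers of two-sided, left and right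
  extensions; summing over all \<open>v\<close> of length \<open>n\<close> and using that the complexity is affine, equality
  holds for every \<open>v\<close>. Hence \<open>r(v) - 1\<close> equals the sum of \<open>r(x) - 1\<close> over the left extensions
  \<open>x\<close> of \<open>v\<close>. The factors in which \<open>w\<close> occurs only as a prefix are the inner nodes of
  the tree of prefixes whose leaves are the complete return words \<open>r w\<close>, so there are
  \<open>1 + \<Sum> (r(v) - 1)\<close> return words, where \<open>v\<close> ranges over these factors. As they form a
  maximal suffix code, the sum is the same as that over all factors of a large length \<open>N\<close>,
  namely \<open>C(N + 1) - C(N) = k - 1\<close>.
\<close>

section \<open>Factors of an infinite word and their extensions\<close>

definition factors :: "'a word \<Rightarrow> nat \<Rightarrow> 'a list set" where
  "factors u n = {w \<in> language u. length w = n}"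

text \<open>Extensions are whole factors, not letters: this makes them fibres of
  \<open>butlast\<close> and \<open>tl\<close> between sets of factors, and later vertices and edges
  of a graph.\<close>

definition rext :: "'a word \<Rightarrow> 'a list \<Rightarrow> 'a list set" where
  "rext u v = {x \<in> factors u (Suc (length v)). butlast x = v}"

definition lext :: "'a word \<Rightarrow> 'a list \<Rightarrow> 'a list set" where
  "lext u v = {x \<in> factors u (Suc (length v)). tl x = v}"

definition bext :: "'a word \<Rightarrow> 'a list \<Rightarrow> 'a list set" where
  "bext u v = {x \<in> factors u (Suc (Suc (length v))). butlast (tl x) = v}"

lemma language_iff: "w \<in> language u \<longleftrightarrow> (\<exists>i. w = u [i \<rightarrow> i + length w])"
proof
  assume "w \<in> language u"
  then obtain i j where "w = u [i \<rightarrow> j]" "i \<le> j" by (auto simp: language_def)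
  then have "w = u [i \<rightarrow> i + length w]" by (simp add: subsequence_def)
  then show "\<exists>i. w = u [i \<rightarrow> i + length w]" ..
qed (auto simp: language_def intro: le_add1)

lemma factors_eq_range: "factors u n = range (\<lambda>i. u [i \<rightarrow> i + n])"
proof -
  have "u [i \<rightarrow> i + n] \<in> language u" for i
    unfolding language_def using le_add1 by blast
  moreover have "length (u [i \<rightarrow> i + n]) = n" for i by simp
  ultimately show ?thesis unfolding factors_def by (auto simp: language_iff)
qed

lemma factors_length: "x \<in> factors u n \<Longrightarrow> length x = n"
  by (simp add: factors_def)

lemma language_factors: "w \<in> language u \<longleftrightarrow> w \<in> factors u (length w)"
  by (simp add: factors_def)

lemma take_in_language:
  assumes "x \<in> language u" shows "take m x \<in> language u"
proof -
  from assms obtain i j where "x = u [i \<rightarrow> j]" "i \<le> j" by (auto simp: language_def)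
  then have "take m x = u [i \<rightarrow> min (i + m) j]" "i \<le> min (i + m) j" by simp_all
  then show ?thesis unfolding language_def by blast
qed

lemma drop_in_language:
  assumes "x \<in> language u" shows "drop m x \<in> language u"
proof -
  from assms obtain i j where ij: "x = u [i \<rightarrow> j]" "i \<le> j" by (auto simp: language_def)
  have "drop m x = u [min (i + m) j \<rightarrow> j]" "min (i + m) j \<le> j"
    using ij by (auto simp: min_def)
  then show ?thesis unfolding language_def by blast
qed

lemma butlast_in_factors: "x \<in> factors u (Suc n) \<Longrightarrow> butlast x \<in> factors u n"
  by (simp add: factors_def butlast_conv_take take_in_language)

lemma tl_in_factors: "x \<in> factors u (Suc n) \<Longrightarrow> tl x \<in> factors u n"
  using drop_in_language[of x u 1] by (simp add: factors_def drop_Suc)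

lemma rext_iff: "x \<in> rext u v \<longleftrightarrow> x \<in> language u \<and> x \<noteq> [] \<and> butlast x = v"
  by (cases x rule: rev_cases) (auto simp: rext_def factors_def)

lemma rext_nonempty: "v \<in> language u \<Longrightarrow> rext u v \<noteq> {}"
proof -
  assume "v \<in> language u"
  then obtain i where i: "v = u [i \<rightarrow> i + length v]" by (auto simp: language_iff)
  have "butlast (u [i \<rightarrow> i + Suc (length v)]) = v"
    using i by (simp add: butlast_conv_take)
  then have "u [i \<rightarrow> i + Suc (length v)] \<in> rext u v"
    unfolding rext_def factors_eq_range by blast
  then show ?thesis by blast
qed

section \<open>Counting factors and two-sided extensions by fibres\<close>

lemma card_eq_sum_fibres:
  assumes "finite X" "finite Y" "f ` X \<subseteq> Y"
  shows "card X = (\<Sum>y\<in>Y. card {x \<in> X. f x = y})"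
  using sum.group[OF assms, of "\<lambda>_. 1::nat"] by simp

lemma card_factors_rext:
  assumes "\<And>n. finite (factors u n)"
  shows "card (factors u (Suc n)) = (\<Sum>v\<in>factors u n. card (rext u v))"
proof -
  have "butlast ` factors u (Suc n) \<subseteq> factors u n"
    by (auto intro: butlast_in_factors)
  then have "card (factors u (Suc n))
      = (\<Sum>v\<in>factors u n. card {x \<in> factors u (Suc n). butlast x = v})"
    by (rule card_eq_sum_fibres[OF assms assms])
  also have "\<dots> = (\<Sum>v\<in>factors u n. card (rext u v))"
    by (rule sum.cong) (auto simp: rext_def factors_def)
  finally show ?thesis .
qed

lemma card_factors_lext:
  assumes "\<And>n. finite (factors u n)"
  shows "card (factors u (Suc n)) = (\<Sum>v\<in>factors u n. card (lext u v))"
proof -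
  have "tl ` factors u (Suc n) \<subseteq> factors u n"
    by (auto intro: tl_in_factors)
  then have "card (factors u (Suc n))
      = (\<Sum>v\<in>factors u n. card {x \<in> factors u (Suc n). tl x = v})"
    by (rule card_eq_sum_fibres[OF assms assms])
  also have "\<dots> = (\<Sum>v\<in>factors u n. card (lext u v))"
    by (rule sum.cong) (auto simp: lext_def factors_def)
  finally show ?thesis .
qed

lemma card_factors_bext:
  assumes "\<And>n. finite (factors u n)"
  shows "card (factors u (Suc (Suc n))) = (\<Sum>v\<in>factors u n. card (bext u v))"
proof -
  have "(\<lambda>x. butlast (tl x)) ` factors u (Suc (Suc n)) \<subseteq> factors u n"
    by (auto intro: tl_in_factors butlast_in_factors)
  then have "card (factors u (Suc (Suc n)))
      = (\<Sum>v\<in>factors u n. card {x \<in> factors u (Suc (Suc n)). (\<lambda>x. butlast (tl x)) x = v})"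
    by (rule card_eq_sum_fibres[OF assms assms])
  also have "\<dots> = (\<Sum>v\<in>factors u n. card (bext u v))"
    by (rule sum.cong) (auto simp: bext_def factors_def)
  finally show ?thesis .
qed

text \<open>A two-sided extension \<open>a # v @ [b]\<close> is a right extension of the left
  extension \<open>a # v\<close>, so grouping by \<open>butlast\<close> gives the count.\<close>

lemma card_bext_rext:
  assumes "\<And>n. finite (factors u n)"
  shows "card (bext u v) = (\<Sum>x\<in>lext u v. card (rext u x))"
proof -
  have "finite (bext u v)" "finite (lext u v)"
    using assms by (simp_all add: bext_def lext_def)
  moreover have "butlast ` bext u v \<subseteq> lext u v"
    by (auto simp: bext_def lext_def butlast_in_factors butlast_tl)
  ultimately have "card (bext u v) = (\<Sum>x\<in>lext u v. card {y \<in> bext u v. butlast y = x})"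
    by (rule card_eq_sum_fibres)
  also have "\<dots> = (\<Sum>x\<in>lext u v. card (rext u x))"
  proof (rule sum.cong)
    fix x assume "x \<in> lext u v"
    then have "length x = Suc (length v)" "tl x = v"
      by (auto simp: lext_def dest: factors_length)
    then have "butlast (tl y) = v" if "butlast y = x" for y
      using that by (simp add: butlast_tl)
    with \<open>length x = Suc (length v)\<close> have "{y \<in> bext u v. butlast y = x} = rext u x"
      unfolding bext_def rext_def by auto
    then show "card {y \<in> bext u v. butlast y = x} = card (rext u x)" by simp
  qed simp
  finally show ?thesis .
qed

section \<open>Return words in a neutral language\<close>

text \<open>Integer-valued, so that sums split into true differences of cardinalities; it measures
  the branching at \<open>v\<close> in the tree of right extensions.\<close>

definition excess :: "'a word \<Rightarrow> 'a list \<Rightarrow> int" where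
  "excess u v = int (card (rext u v)) - 1"

definition lexts :: "'a word \<Rightarrow> nat \<Rightarrow> 'a list \<Rightarrow> 'a list set" where
  "lexts u m v = {x \<in> factors u (m + length v). drop m x = v}"

text \<open>Neutrality reads e - l = r - 1, and e - l is the total excess of the left extensions.
  Excess is thus conserved under extension to the left by one letter, hence by \<open>m\<close>
  letters.\<close>

lemma sum_excess_lexts:
  assumes fin: "\<And>n. finite (factors u n)"
    and neutral: "\<forall>v\<in>language u.
      card (bext u v) + 1 = card (lext u v) + card (rext u v)"
    and v: "v \<in> language u"
  shows "(\<Sum>x\<in>lexts u m v. excess u x) = excess u v"
proof (induction m)
  case 0
  have "lexts u 0 v = {v}" using v by (auto simp: lexts_def factors_def)
  then show ?case by simp
next
  case (Suc m)
  have "finite (lexts u (Suc m) v)" "finite (lexts u m v)"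
    using fin by (simp_all add: lexts_def)
  moreover have "tl ` lexts u (Suc m) v \<subseteq> lexts u m v"
    by (auto simp: lexts_def tl_in_factors drop_Suc)
  ultimately have "(\<Sum>x\<in>lexts u (Suc m) v. excess u x)
      = (\<Sum>y\<in>lexts u m v. \<Sum>x\<in>{x \<in> lexts u (Suc m) v. tl x = y}. excess u x)"
    by (rule sum.group[symmetric])
  also have "\<dots> = (\<Sum>y\<in>lexts u m v. excess u y)"
  proof (rule sum.cong)
    fix y assume y: "y \<in> lexts u m v"
    then have "length y = m + length v" "drop m y = v"
      by (auto simp: lexts_def dest: factors_length)
    then have eq: "{x \<in> lexts u (Suc m) v. tl x = y} = lext u y"
      by (auto simp: lexts_def lext_def drop_Suc)
    have "y \<in> language u" using y by (simp add: lexts_def factors_def)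
    then have "int (card (bext u y)) + 1 = int (card (lext u y)) + int (card (rext u y))"
      using neutral by (metis of_nat_1 of_nat_add)
    moreover have "(\<Sum>x\<in>lext u y. excess u x) = int (card (bext u y)) - int (card (lext u y))"
      by (simp add: excess_def card_bext_rext[OF fin] sum_subtractf)
    ultimately show "(\<Sum>x\<in>{x \<in> lexts u (Suc m) v. tl x = y}. excess u x) = excess u y"
      unfolding eq by (simp add: excess_def)
  qed simp
  finally show ?case using Suc by simp
qed

section \<open>Occurrences inside a factor, and factors with a single occurrence\<close>

definition occ_at :: "'a list \<Rightarrow> 'a list \<Rightarrow> nat \<Rightarrow> bool" where
  "occ_at w x p \<longleftrightarrow> p + length w \<le> length x \<and> take (length w) (drop p x) = w"

text \<open>The equivalence makes \<open>w\<close> a prefix and forbids all other occurrences,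
  overlapping ones included. For \<open>w = []\<close> the length bound in \<open>occ_at\<close>
  leaves exactly \<open>[]\<close>.\<close>

definition single_occ :: "'a word \<Rightarrow> 'a list \<Rightarrow> 'a list set" where
  "single_occ u w = {v \<in> language u. \<forall>p. occ_at w v p \<longleftrightarrow> p = 0}"

lemma occurrence_iff: "occurrence u w i \<longleftrightarrow> u [i \<rightarrow> i + length w] = w"
  by (simp add: occurrence_def)

lemma occ_at_subsequence:
  "occ_at w (u [i \<rightarrow> i + n]) p \<longleftrightarrow> p + length w \<le> n \<and> occurrence u w (i + p)"
proof (cases "p + length w \<le> n")
  case True
  then have "min (i + p + length w) (i + n) = i + p + length w" by simp
  then show ?thesis using True by (simp add: occ_at_def occurrence_iff)
qed (simp add: occ_at_def)

lemma occ_at_drop: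
  "q \<le> length x \<Longrightarrow> occ_at w (drop q x) p \<longleftrightarrow> occ_at w x (q + p)"
  by (auto simp: occ_at_def add.commute[of p q])

lemma occ_at_butlast:
  assumes "x \<noteq> []"
  shows "occ_at w (butlast x) p \<longleftrightarrow> occ_at w x p \<and> p + length w < length x"
proof (cases "p + length w < length x")
  case True
  then have "take (length w) (drop p (butlast x)) = take (length w) (drop p x)"
    by (simp add: butlast_conv_take take_drop min_def)
  then show ?thesis using True by (auto simp: occ_at_def)
next
  case False
  then show ?thesis using assms by (cases x) (auto simp: occ_at_def)
qed

lemma single_occ_language: "v \<in> single_occ u w \<Longrightarrow> v \<in> language u"
  by (simp add: single_occ_def)

lemma occ_at_single_occ: "v \<in> single_occ u w \<Longrightarrow> occ_at w v p \<longleftrightarrow> p = 0"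
  by (simp add: single_occ_def)

lemma occ_at_self: "occ_at w w p \<longleftrightarrow> p = 0"
  by (auto simp: occ_at_def)

lemma single_occ_self: "w \<in> language u \<Longrightarrow> w \<in> single_occ u w"
  by (simp add: single_occ_def occ_at_self)

text \<open>If \<open>v\<close> were longer than \<open>N\<close>, its suffix of length
  \<open>N\<close> would contain \<open>w\<close>, at a positive position of
  \<open>v\<close>.\<close>

lemma single_occ_length_le:
  assumes occ: "\<forall>x\<in>factors u N. \<exists>p. occ_at w x p"
    and v: "v \<in> single_occ u w"
  shows "length v \<le> N"
proof (rule ccontr)
  assume "\<not> length v \<le> N"
  define q where "q = length v - N"
  have q: "q \<le> length v" "q > 0" "length v - q = N"
    using \<open>\<not> length v \<le> N\<close> by (auto simp: q_def)
  have "drop q v \<in> factors u N"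
    using q drop_in_language[OF single_occ_language[OF v]] by (simp add: factors_def)
  then obtain p where "occ_at w (drop q v) p" using occ by blast
  then have "occ_at w v (q + p)" using q by (simp add: occ_at_drop)
  then show False using occ_at_single_occ[OF v] q by simp
qed

lemma finite_single_occ:
  assumes "\<And>n. finite (factors u n)"
    and "\<forall>x\<in>factors u N. \<exists>p. occ_at w x p"
  shows "finite (single_occ u w)"
proof (rule finite_subset)
  show "single_occ u w \<subseteq> (\<Union>n\<le>N. factors u n)"
    using single_occ_length_le[OF assms(2)] single_occ_language
    by (fastforce simp: language_factors)
qed (use assms(1) in simp)

text \<open>The shorter suffix starts with \<open>w\<close>, which puts an occurrence of
  \<open>w\<close> at position \<open>m' - m\<close> of the longer one, where only position 0 is
  allowed.\<close>

lemma single_occ_suffix_code: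
  assumes v: "v \<in> single_occ u w" and v': "v' \<in> single_occ u w"
    and "drop m x = v" "drop m' x = v'" "m \<le> m'" "m' \<le> length x"
  shows "v = v'"
proof -
  have "drop (m' - m) v = v'" using assms by (auto simp add: drop_drop)
  moreover have "m' - m \<le> length v" using assms by auto
  ultimately have "occ_at w v (m' - m)"
    using occ_at_drop[of "m' - m" v w 0] occ_at_single_occ[OF v'] by simp
  then have "m' - m = 0" using occ_at_single_occ[OF v] by simp
  then show ?thesis using \<open>drop (m' - m) v = v'\<close> by simp
qed

text \<open>Cutting a factor at the last occurrence of \<open>w\<close> shows that \<open>single_occ u w\<close> is a
  maximal suffix code.\<close>

lemma factors_eq_UN_lexts:
  assumes occ: "\<forall>x\<in>factors u N. \<exists>p. occ_at w x p"
  shows "factors u N = (\<Union>v\<in>single_occ u w. lexts u (N - length v) v)"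
proof (intro subset_antisym subsetI)
  fix x assume x: "x \<in> factors u N"
  define q where "q = Max {p. occ_at w x p}"
  have le: "p \<le> length x" if "occ_at w x p" for p
    using that by (simp add: occ_at_def)
  then have fin: "finite {p. occ_at w x p}"
    by (meson finite_nat_set_iff_bounded_le mem_Collect_eq)
  have q: "occ_at w x q"
    using Max_in[OF fin] occ x by (auto simp: q_def)
  have max: "p \<le> q" if "occ_at w x p" for p
    using Max_ge[OF fin] that by (simp add: q_def)
  have len: "length x = N" "x \<in> language u" using x by (simp_all add: factors_def)
  have "occ_at w (drop q x) p \<longleftrightarrow> p = 0" for p
    using occ_at_drop[OF le[OF q]] q max[of "q + p"] by auto
  then have "drop q x \<in> single_occ u w"
    by (simp add: single_occ_def drop_in_language len)
  moreover have "x \<in> lexts u (N - length (drop q x)) (drop q x)"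
    using x len le[OF q] by (simp add: lexts_def)
  ultimately show "x \<in> (\<Union>v\<in>single_occ u w. lexts u (N - length v) v)" by blast
next
  fix x assume "x \<in> (\<Union>v\<in>single_occ u w. lexts u (N - length v) v)"
  then show "x \<in> factors u N"
    using single_occ_length_le[OF occ] by (auto simp: lexts_def)
qed

text \<open>The factors of length \<open>N\<close> are partitioned by their unique suffix in the
  code, and by \<open>sum_excess_lexts\<close> each block carries the excess of its suffix.\<close>

lemma sum_excess_single_occ:
  assumes fin: "\<And>n. finite (factors u n)"
    and neutral: "\<forall>v\<in>language u.
      card (bext u v) + 1 = card (lext u v) + card (rext u v)"
    and occ: "\<forall>x\<in>factors u N. \<exists>p. occ_at w x p"
  shows "(\<Sum>v\<in>single_occ u w. excess u v) = (\<Sum>x\<in>factors u N. excess u x)"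
proof -
  have disj: "lexts u (N - length v) v \<inter> lexts u (N - length v') v' = {}"
    if v: "v \<in> single_occ u w" "v' \<in> single_occ u w" "v \<noteq> v'" for v v'
  proof (rule ccontr)
    assume "\<not> ?thesis"
    then obtain x where x: "drop (N - length v) x = v" "drop (N - length v') x = v'" "length x = N"
      using single_occ_length_le[OF occ v(1)]
      by (auto simp: lexts_def factors_def)
    show False
    proof (cases "N - length v \<le> N - length v'")
      case True
      then show False using single_occ_suffix_code[OF v(1,2) x(1,2)] x v(3) by simp
    next
      case False
      then show False using single_occ_suffix_code[OF v(2,1) x(2,1)] x v(3) by simp
    qed
  qed
  have "(\<Sum>x\<in>factors u N. excess u x)
      = (\<Sum>v\<in>single_occ u w. \<Sum>x\<in>lexts u (N - length v) v. excess u x)"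
    unfolding factors_eq_UN_lexts[OF occ]
    by (rule sum.UNION_disjoint)
      (use finite_single_occ[OF fin occ] fin disj in \<open>auto simp: lexts_def\<close>)
  also have "\<dots> = (\<Sum>v\<in>single_occ u w. excess u v)"
    using sum_excess_lexts[OF fin neutral] by (simp add: single_occ_language)
  finally show ?thesis ..
qed

text \<open>A letter whose addition leaves \<open>single_occ u w\<close> completes a second
  occurrence of \<open>w\<close>, as a suffix; the resulting words are the \<open>r @ w\<close> with
  \<open>r\<close> a return word.\<close>

definition complete_returns :: "'a word \<Rightarrow> 'a list \<Rightarrow> 'a list set" where
  "complete_returns u w =
    {x \<in> language u. x \<noteq> [] \<and> butlast x \<in> single_occ u w} - single_occ u w"

lemma occ_at_zero_length: "occ_at w x 0 \<Longrightarrow> length x \<le> length w \<Longrightarrow> x = w"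
  unfolding occ_at_def by (metis take_all drop_0)

text \<open>Count in the tree with root \<open>w\<close> and inner nodes
  \<open>single_occ u w\<close>: the leaves are all children minus the inner nodes other than the
  root.\<close>

lemma card_complete_returns:
  assumes fin: "finite (single_occ u w)" "\<And>n. finite (factors u n)" and w: "w \<in> language u"
  shows "int (card (complete_returns u w)) = 1 + (\<Sum>v\<in>single_occ u w. excess u v)"
proof -
  define X where "X = {x \<in> language u. x \<noteq> [] \<and> butlast x \<in> single_occ u w}"
  have fibre: "{x \<in> X. butlast x = v} = rext u v" if "v \<in> single_occ u w" for v
    using that by (auto simp: X_def rext_iff)
  have "X \<subseteq> (\<Union>v\<in>single_occ u w. rext u v)"
    using fibre by (auto simp: X_def)
  then have finX: "finite X"
    by (rule finite_subset) (use fin in \<open>auto simp: rext_def\<close>)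
  have "card X = (\<Sum>v\<in>single_occ u w. card {x \<in> X. butlast x = v})"
    using finX fin(1) by (rule card_eq_sum_fibres) (auto simp: X_def)
  then have cardX: "card X = (\<Sum>v\<in>single_occ u w. card (rext u v))"
    using fibre by simp
  \<comment> \<open>Dropping the last letter of an inner node other than \<open>w\<close> keeps the
    prefix \<open>w\<close>, while \<open>butlast\<close> of the root is too short to contain
    \<open>w\<close>.\<close>
  have "X \<inter> single_occ u w = single_occ u w - {w}"
  proof (intro subset_antisym subsetI)
    fix x assume "x \<in> X \<inter> single_occ u w"
    then have x: "x \<noteq> []" "butlast x \<in> single_occ u w" "x \<in> single_occ u w"
      by (auto simp: X_def)
    have "occ_at w (butlast x) 0" using occ_at_single_occ[OF x(2)] by simp
    then have "length w < length x" using occ_at_butlast[OF x(1)] by simp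
    then show "x \<in> single_occ u w - {w}" using x by auto
  next
    fix x assume "x \<in> single_occ u w - {w}"
    then have x: "x \<in> single_occ u w" "x \<noteq> w" by auto
    have occ: "occ_at w x 0" using occ_at_single_occ[OF x(1)] by simp
    then have len: "length w < length x" using occ_at_zero_length x(2) not_le by blast
    then have ne: "x \<noteq> []" by auto
    have "occ_at w (butlast x) p \<longleftrightarrow> p = 0" for p
      using occ_at_butlast[OF ne] occ_at_single_occ[OF x(1)] len by auto
    moreover have "butlast x \<in> language u"
      using take_in_language[OF single_occ_language[OF x(1)]] by (simp add: butlast_conv_take)
    ultimately have "butlast x \<in> single_occ u w" by (simp add: single_occ_def)
    then show "x \<in> X \<inter> single_occ u w" using x ne by (auto simp: X_def single_occ_language)
  qed
  then have "card (X \<inter> single_occ u w) + 1 = card (single_occ u w)"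
    using single_occ_self[OF w] fin(1) by (metis card_Suc_Diff1 Suc_eq_plus1)
  moreover have "card (complete_returns u w) + card (X \<inter> single_occ u w) = card X"
    unfolding complete_returns_def X_def[symmetric] using finX
    by (metis card_Diff_subset_Int card_mono finite_Int inf_le1 le_add_diff_inverse2)
  ultimately show ?thesis
    by (simp add: excess_def cardX sum_subtractf flip: of_nat_sum)
qed

lemma card_return_words_eq: "card (return_words u w) = card (complete_returns u w)"
proof -
  have "(\<lambda>r. r @ w) ` return_words u w = complete_returns u w"
  proof (intro subset_antisym subsetI)
    fix x assume "x \<in> (\<lambda>r. r @ w) ` return_words u w"
    then obtain i j where ij: "x = u [i \<rightarrow> j] @ w" "successive_occurrences u w i j"
      by (auto simp: return_words_def)
    define n where "n = j - i + length w"
    have *: "i < j" "occurrence u w i" "occurrence u w j"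
      "\<And>m. i < m \<Longrightarrow> m < j \<Longrightarrow> \<not> occurrence u w m"
      using ij by (auto simp: successive_occurrences_def)
    \<comment> \<open>The two occurrences may overlap, but the window of length \<open>n\<close>
      still splits at \<open>j\<close>.\<close>
    have "u [i \<rightarrow> i + n] = u [i \<rightarrow> j] @ u [j \<rightarrow> j + length w]"
      using append_take_drop_id[of "j - i" "u [i \<rightarrow> i + n]"] \<open>i < j\<close> by (simp add: n_def)
    then have x: "x = u [i \<rightarrow> i + n]"
      using ij(1) *(3) by (simp add: occurrence_iff)
    have n: "n > 0" using *(1) by (simp add: n_def)
    then have bl: "butlast x = u [i \<rightarrow> i + (n - 1)]"
      by (simp add: x butlast_conv_take)
    have "occ_at w (butlast x) p \<longleftrightarrow> p = 0" for p
      unfolding bl occ_at_subsequence using *(1,2) *(4)[of "i + p"]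
      by (cases "p = 0") (auto simp: n_def)
    then have "butlast x \<in> single_occ u w"
      unfolding single_occ_def bl by (auto simp: language_iff)
    moreover have "occ_at w x (j - i)"
      unfolding x occ_at_subsequence using * by (simp add: n_def)
    then have "x \<notin> single_occ u w"
      using occ_at_single_occ *(1) by (metis diff_is_0_eq not_le)
    moreover have "x \<in> language u" "x \<noteq> []"
      using n by (auto simp: x language_iff)
    ultimately show "x \<in> complete_returns u w" by (simp add: complete_returns_def)
  next
    fix x assume "x \<in> complete_returns u w"
    then have x: "x \<in> language u" "x \<noteq> []" "butlast x \<in> single_occ u w" "x \<notin> single_occ u w"
      by (auto simp: complete_returns_def)
    define n where "n = length x"
    obtain i where i: "x = u [i \<rightarrow> i + n]" using x(1) by (auto simp: language_iff n_def)
    have bl: "occ_at w x p \<and> p + length w < n \<longleftrightarrow> p = 0" for p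
      using occ_at_butlast[OF x(2)] occ_at_single_occ[OF x(3)] by (simp add: n_def)
    then obtain p where p: "occ_at w x p" "p \<noteq> 0"
      using x(1,4) by (auto simp: single_occ_def)
    \<comment> \<open>Every occurrence ending before the last letter starts at 0, so the new one is
      a suffix.\<close>
    have pn: "p + length w = n"
      using bl[of p] p by (auto simp: occ_at_def n_def)
    have occ: "occ_at w x q \<longleftrightarrow> q + length w \<le> n \<and> occurrence u w (i + q)" for q
      by (subst i) (rule occ_at_subsequence)
    have "successive_occurrences u w i (i + p)"
      unfolding successive_occurrences_def
    proof (intro conjI allI impI)
      show "i < i + p" using p by simp
      show "occurrence u w i" using bl[of 0] occ[of 0] by simp
      show "occurrence u w (i + p)" using occ p by simp
      fix m assume m: "i < m \<and> m < i + p"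
      show "\<not> occurrence u w m"
        using bl[of "m - i"] occ[of "m - i"] m pn by auto
    qed
    then have "u [i \<rightarrow> i + p] \<in> return_words u w" by (auto simp: return_words_def)
    moreover have "x = u [i \<rightarrow> i + p] @ w"
    proof -
      have "take p x = u [i \<rightarrow> i + p]" using pn by (simp add: i)
      moreover have "drop p x = w" using p(1) pn by (simp add: occ_at_def n_def)
      ultimately show ?thesis by (metis append_take_drop_id)
    qed
    ultimately show "x \<in> (\<lambda>r. r @ w) ` return_words u w" by blast
  qed
  moreover have "inj_on (\<lambda>r. r @ w) (return_words u w)" by (simp add: inj_on_def)
  ultimately show ?thesis by (metis card_image)
qed

theorem card_return_words_neutral:
  assumes fin: "\<And>n. finite (factors u n)"
    and neutral: "\<forall>v\<in>language u.
      card (bext u v) + 1 = card (lext u v) + card (rext u v)"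
    and occ: "\<forall>x\<in>factors u N. \<exists>p. occ_at w x p"
    and w: "w \<in> language u"
  shows "int (card (return_words u w))
    = 1 + int (card (factors u (Suc N))) - int (card (factors u N))"
proof -
  have "(\<Sum>x\<in>factors u N. excess u x)
      = int (card (factors u (Suc N))) - int (card (factors u N))"
    by (simp add: card_factors_rext[OF fin] excess_def sum_subtractf)
  then show ?thesis
    by (simp add: card_return_words_eq card_complete_returns[OF finite_single_occ[OF fin occ] fin w]
        sum_excess_single_occ[OF fin neutral occ])
qed

section \<open>The graph of factors up to reversal\<close>

text \<open>Absorbing the vertices outside \<open>W\<close> one at a time, each along a crossing edge, uses up a new
  edge per vertex. Connectedness is stated as the existence of such crossing edges.\<close>

lemma card_edges_within:
  fixes ends :: "'e \<Rightarrow> 'v set"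
  assumes "finite V" "finite E" "W \<subseteq> V" "W \<noteq> {}"
    and cut: "\<And>U. U \<subset> V \<Longrightarrow> U \<noteq> {} \<Longrightarrow>
      \<exists>e\<in>E. \<not> ends e \<subseteq> U \<and> (\<exists>x\<in>V - U. ends e \<subseteq> insert x U)"
  shows "card {e \<in> E. ends e \<subseteq> W} + card V \<le> card E + card W"
  using assms(3,4)
proof (induction "card (V - W)" arbitrary: W)
  case 0
  then have "W = V" using \<open>finite V\<close> by auto
  then show ?case using \<open>finite E\<close> by (auto intro: card_mono)
next
  case (Suc d)
  then have "W \<subset> V" by auto
  then obtain e x where e: "e \<in> E" "\<not> ends e \<subseteq> W" "x \<in> V - W" "ends e \<subseteq> insert x W"
    using cut[OF _ Suc.prems(2)] by meson
  have "d = card (V - insert x W)"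
    using Suc.hyps(2) e(3) \<open>finite V\<close>
    by (metis Diff_insert card_Diff_singleton diff_Suc_1)
  then have IH: "card {e \<in> E. ends e \<subseteq> insert x W} + card V \<le> card E + card (insert x W)"
    using Suc.hyps(1) Suc.prems e(3) by blast
  \<comment> \<open>The crossing edge \<open>e\<close> makes the inclusion strict.\<close>
  have "{e \<in> E. ends e \<subseteq> W} \<subset> {e \<in> E. ends e \<subseteq> insert x W}"
    using e by blast
  then have "card {e \<in> E. ends e \<subseteq> W} < card {e \<in> E. ends e \<subseteq> insert x W}"
    using \<open>finite E\<close> by (simp add: psubset_card_mono)
  moreover have "card (insert x W) = Suc (card W)"
    using e(3) Suc.prems \<open>finite V\<close> by (simp add: finite_subset)
  ultimately show ?case using IH by simp
qed

text \<open>The orbit under reversal, a singleton exactly for palindromes.\<close>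

definition cls :: "'a list \<Rightarrow> 'a list set" where
  "cls w = {w, rev w}"

definition palindromes :: "'a word \<Rightarrow> nat \<Rightarrow> 'a list set" where
  "palindromes u n = {w \<in> factors u n. palindrome w}"

lemma cls_rev [simp]: "cls (rev w) = cls w"
  by (auto simp: cls_def)

lemma cls_eq_iff: "cls v = cls w \<longleftrightarrow> v = w \<or> v = rev w"
  by (auto simp: cls_def doubleton_eq_iff)

lemma palindrome_rev [simp]: "palindrome (rev w) \<longleftrightarrow> palindrome w"
  by (auto simp: palindrome_def)

lemma card_cls_nonpalindromes:
  assumes "finite X" "\<And>x. x \<in> X \<Longrightarrow> rev x \<in> X" "\<And>x. x \<in> X \<Longrightarrow> \<not> palindrome x"
  shows "card X = 2 * card (cls ` X)"
proof -
  have "card X = (\<Sum>c\<in>cls ` X. card {x \<in> X. cls x = c})"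
    using assms(1) by (intro card_eq_sum_fibres) auto
  also have "\<dots> = (\<Sum>c\<in>cls ` X. 2)"
  proof (rule sum.cong)
    fix c assume "c \<in> cls ` X"
    then obtain x where x: "x \<in> X" "c = cls x" by blast
    then have "{x \<in> X. cls x = c} = {x, rev x}"
      using assms(2) by (auto simp: cls_eq_iff)
    moreover have "x \<noteq> rev x" using assms(3)[OF x(1)] by (metis palindrome_def)
    ultimately show "card {x \<in> X. cls x = c} = 2" by simp
  qed simp
  finally show ?thesis by simp
qed

text \<open>Orbit counting for the involution \<open>rev\<close>, whose fixed points are the
  palindromes.\<close>

lemma card_cls:
  assumes "finite X" "\<And>x. x \<in> X \<Longrightarrow> rev x \<in> X"
  shows "2 * card (cls ` X) = card X + card {x \<in> X. palindrome x}"
proof -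
  let ?P = "{x \<in> X. palindrome x}" and ?N = "{x \<in> X. \<not> palindrome x}"
  have X: "X = ?P \<union> ?N" "?P \<inter> ?N = {}" by auto
  have "cls ` X = cls ` ?P \<union> cls ` ?N" using X(1) by blast
  moreover have "cls ` ?P \<inter> cls ` ?N = {}"
    by (auto simp: cls_eq_iff)
  ultimately have "card (cls ` X) = card (cls ` ?P) + card (cls ` ?N)"
    using assms(1) by (simp add: card_Un_disjoint)
  moreover have "card ?N = 2 * card (cls ` ?N)"
    using assms by (intro card_cls_nonpalindromes) auto
  moreover have "inj_on cls ?P"
    by (auto simp: inj_on_def cls_eq_iff palindrome_def)
  then have "card (cls ` ?P) = card ?P" by (rule card_image)
  moreover have "card X = card ?P + card ?N"
    using assms(1) X by (metis (no_types, lifting) card_Un_disjoint finite_Un)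
  ultimately show ?thesis by simp
qed

lemma butlast_rev: "butlast (rev x) = rev (tl x)"
  by (cases x) auto

lemma tl_rev: "tl (rev x) = rev (butlast x)"
  by (cases x rule: rev_cases) auto

text \<open>Either representative yields the same pair, since reversal exchanges
  \<open>butlast\<close> and \<open>tl\<close> up to \<open>rev\<close>.\<close>

definition ends :: "'a list set \<Rightarrow> 'a list set set" where
  "ends c = (\<Union>x\<in>c. {cls (butlast x), cls (tl x)})"

lemma ends_cls: "ends (cls x) = {cls (butlast x), cls (tl x)}"
  by (auto simp: ends_def cls_def[of x] butlast_rev tl_rev)

lemma consecutive_crossing:
  fixes P :: "nat \<Rightarrow> bool"
  assumes "P i" "\<not> P j"
  shows "\<exists>m. P m \<noteq> P (Suc m)"
proof (rule ccontr)
  assume "\<nexists>m. P m \<noteq> P (Suc m)"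
  then have "P m = P 0" for m by (induction m) auto
  from this[of i] this[of j] show False using assms by simp
qed

text \<open>The graph has vertex set \<open>cls ` factors u n\<close>, and its edges are the classes of the
  non-palindromic factors of length \<open>n + 1\<close>; the palindromic ones are loops. Equality in
  the hypothesis on palindromes says that the graph, which is connected, is a tree.\<close>

lemma card_cls_tree:
  assumes fin: "\<And>n. finite (factors u n)"
    and rev: "\<And>w. w \<in> language u \<Longrightarrow> rev w \<in> language u"
    and pal: "card (palindromes u n) + card (palindromes u (Suc n)) + card (factors u n)
      = card (factors u (Suc n)) + 2"
    and W: "W \<subseteq> factors u n" "W \<noteq> {}"
    and X: "X \<subseteq> factors u (Suc n)"
    and X': "\<And>x. x \<in> X \<Longrightarrow> \<not> palindrome x \<and> cls (butlast x) \<in> cls ` W \<and> cls (tl x) \<in> cls ` W"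
  shows "card (cls ` X) + 1 \<le> card (cls ` W)"
proof -
  define V where "V = cls ` factors u n"
  define Y where "Y = {x \<in> factors u (Suc n). \<not> palindrome x}"
  define E where "E = cls ` Y"
  have revf: "rev x \<in> factors u m" if "x \<in> factors u m" for x m
    using that rev by (simp add: factors_def)
  have "finite Y" using fin by (simp add: Y_def)
  have V: "2 * card V = card (factors u n) + card (palindromes u n)"
    unfolding V_def palindromes_def using fin revf by (rule card_cls)
  have "card Y = 2 * card E"
    unfolding E_def using \<open>finite Y\<close> revf by (intro card_cls_nonpalindromes) (auto simp: Y_def)
  moreover have "card (factors u (Suc n)) = card Y + card (palindromes u (Suc n))"
  proof -
    have "Y \<union> palindromes u (Suc n) = factors u (Suc n)" "Y \<inter> palindromes u (Suc n) = {}"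
      by (auto simp: Y_def palindromes_def)
    then show ?thesis using fin by (metis card_Un_disjoint finite_Un)
  qed
  \<comment> \<open>Twice the difference of vertices and edges is the left side of
    \<open>pal\<close> minus \<open>card (factors u (Suc n))\<close>, that is, 2.\<close>
  ultimately have VE: "card V = card E + 1" using V pal by simp
  have "card {e \<in> E. ends e \<subseteq> cls ` W} + card V \<le> card E + card (cls ` W)"
  proof (rule card_edges_within)
    show "finite V" "finite E" "cls ` W \<subseteq> V" "cls ` W \<noteq> {}"
      using fin \<open>finite Y\<close> W by (auto simp: V_def E_def)
    fix U assume U: "U \<subset> V" "U \<noteq> {}"
    \<comment> \<open>Connectedness: a window of length \<open>n\<close> sliding along
      \<open>u\<close> visits every vertex, so at some step it crosses the boundary of
      \<open>U\<close>.\<close>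
    define c where "c i = cls (u [i \<rightarrow> i + n])" for i
    have V_range: "V = range c" unfolding V_def c_def factors_eq_range by blast
    obtain i j where "c i \<in> U" "c j \<notin> U" using U unfolding V_range by blast
    then obtain m where m: "(c m \<in> U) \<noteq> (c (Suc m) \<in> U)"
      using consecutive_crossing[of "\<lambda>m. c m \<in> U"] by blast
    define x where "x = u [m \<rightarrow> m + Suc n]"
    have x: "x \<in> factors u (Suc n)" unfolding x_def factors_eq_range by blast
    have bx: "cls (butlast x) = c m" by (simp add: x_def c_def butlast_conv_take)
    have "tl x = u [Suc m \<rightarrow> Suc m + n]"
      using subsequence_drop[of 1 u m "m + Suc n"]
      unfolding x_def[symmetric] by (simp add: drop_Suc)
    then have tx: "cls (tl x) = c (Suc m)" by (simp add: c_def)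
    \<comment> \<open>Both ends of a palindrome lie in one class, so it cannot cross.\<close>
    have "\<not> palindrome x"
    proof
      assume "palindrome x"
      then have "tl x = rev (butlast x)" by (metis palindrome_def tl_rev)
      then show False using bx tx m by simp
    qed
    then have "cls x \<in> E" using x by (auto simp: E_def Y_def)
    moreover have "ends (cls x) = {c m, c (Suc m)}" by (simp add: ends_cls bx tx)
    moreover have "c m \<in> V" "c (Suc m) \<in> V" by (auto simp: V_range)
    ultimately show "\<exists>e\<in>E. \<not> ends e \<subseteq> U \<and> (\<exists>x\<in>V - U. ends e \<subseteq> insert x U)"
      using m by (intro bexI[of _ "cls x"]) auto
  qed
  moreover have "card (cls ` X) \<le> card {e \<in> E. ends e \<subseteq> cls ` W}"
    using \<open>finite Y\<close> X X' by (intro card_mono) (auto simp: E_def Y_def ends_cls)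
  ultimately show ?thesis using VE by simp
qed

section \<open>Two-sided extensions as edges of the tree, and neutrality\<close>

lemma lext_iff: "x \<in> lext u v \<longleftrightarrow> x \<in> language u \<and> x \<noteq> [] \<and> tl x = v"
  by (cases x) (auto simp: lext_def factors_def)

lemma bext_iff: "x \<in> bext u v \<longleftrightarrow> x \<in> language u \<and> (\<exists>a b. x = a # v @ [b])"
proof
  assume "x \<in> bext u v"
  then have x: "x \<in> language u" "length x = Suc (Suc (length v))" "butlast (tl x) = v"
    by (auto simp: bext_def factors_def)
  from x(2) obtain a y where y: "x = a # y" "length y = Suc (length v)"
    by (auto simp: length_Suc_conv)
  moreover have "y = v @ [last y]"
    using y x(3) by (metis append_butlast_last_id length_0_conv list.sel(3) nat.distinct(1))
  ultimately show "x \<in> language u \<and> (\<exists>a b. x = a # v @ [b])" using x(1) by blast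
qed (auto simp: bext_def factors_def)

text \<open>Among words of length \<open>length v + 1\<close>, one-sided extensions of
  \<open>v\<close> are vertices joined by the two-sided ones, so the tree bound applies. For a
  palindrome \<open>v\<close> distinct extensions may be reversals of each other, which needs a
  separate count.\<close>

lemma card_bext_le:
  assumes fin: "\<And>n. finite (factors u n)"
    and rev: "\<And>w. w \<in> language u \<Longrightarrow> rev w \<in> language u"
    and pal: "\<And>n. card (palindromes u n) + card (palindromes u (Suc n)) + card (factors u n)
      = card (factors u (Suc n)) + 2"
    and ext: "\<And>w. w \<in> language u \<Longrightarrow> palindrome w \<Longrightarrow> \<exists>!v. palindromic_extension u w v"
    and v: "v \<in> language u"
  shows "card (bext u v) + 1 \<le> card (lext u v) + card (rext u v)"
proof -
  have finl: "finite (lext u v)" "finite (rext u v)" "finite (bext u v)"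
    using fin by (simp_all add: lext_def rext_def bext_def)
  have sub: "lext u v \<subseteq> factors u (Suc (length v))" "rext u v \<subseteq> factors u (Suc (length v))"
    "bext u v \<subseteq> factors u (Suc (Suc (length v)))"
    by (auto simp: lext_def rext_def bext_def)
  have bl: "butlast x \<in> lext u v" "tl x \<in> rext u v" if "x \<in> bext u v" for x
    using that sub by (auto simp: bext_def lext_def rext_def butlast_tl
        intro: butlast_in_factors tl_in_factors)
  show ?thesis
  proof (cases "palindrome v")
    case False
    \<comment> \<open>Distinct extensions share a class only as reversals of each other, which would
      make \<open>v\<close> a palindrome.\<close>
    have "x = y" if "x \<in> bext u v" "y \<in> bext u v" "cls x = cls y" for x y
      using that False by (auto simp: bext_iff cls_eq_iff palindrome_def)
    then have "card (cls ` bext u v) = card (bext u v)"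
      by (intro card_image) (auto simp: inj_on_def)
    moreover have "card (cls ` bext u v) + 1 \<le> card (cls ` (lext u v \<union> rext u v))"
    proof (rule card_cls_tree[OF fin rev pal])
      show "lext u v \<union> rext u v \<noteq> {}" using rext_nonempty[OF v] by simp
      fix x assume x: "x \<in> bext u v"
      then show "\<not> palindrome x \<and> cls (butlast x) \<in> cls ` (lext u v \<union> rext u v)
          \<and> cls (tl x) \<in> cls ` (lext u v \<union> rext u v)"
        using bl[OF x] False by (auto simp: bext_iff palindrome_def)
    qed (use sub in auto)
    moreover have "card (cls ` (lext u v \<union> rext u v)) \<le> card (lext u v) + card (rext u v)"
      using finl by (meson card_Un_le card_image_le finite_UnI le_trans)
    ultimately show ?thesis by simp
  next
    case True
    then have rv: "rev v = v" by (simp add: palindrome_def)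
    \<comment> \<open>Hence the classes of the left extensions are all the vertices
      required.\<close>
    have revl: "rev ` lext u v = rext u v"
    proof (intro subset_antisym subsetI)
      fix x assume "x \<in> rext u v"
      then have "rev x \<in> lext u v" using rev rv by (auto simp: rext_iff lext_iff tl_rev)
      then show "x \<in> rev ` lext u v" by (metis imageI rev_rev_ident)
    qed (use rev rv in \<open>auto simp: rext_iff lext_iff butlast_rev\<close>)
    have card_lr: "card (rext u v) = card (lext u v)"
      unfolding revl[symmetric] by (simp add: card_image)
    define X where "X = {x \<in> bext u v. \<not> palindrome x}"
    have revb: "rev x \<in> bext u v" if "x \<in> bext u v" for x
      using that rev[of x] rv by (auto simp: bext_iff)
    have "card X = 2 * card (cls ` X)"
      using finl revb by (intro card_cls_nonpalindromes) (auto simp: X_def)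
    moreover have "card (cls ` X) + 1 \<le> card (cls ` lext u v)"
    proof (rule card_cls_tree[OF fin rev pal])
      show "lext u v \<noteq> {}" using rext_nonempty[OF v] revl by auto
      fix x assume x: "x \<in> X"
      then have "tl x \<in> rev ` lext u v" using bl revl by (simp add: X_def)
      then have "cls (tl x) \<in> cls ` lext u v" by auto
      then show "\<not> palindrome x \<and> cls (butlast x) \<in> cls ` lext u v \<and> cls (tl x) \<in> cls ` lext u v"
        using x bl by (auto simp: X_def)
    qed (use sub in \<open>auto simp: X_def\<close>)
    moreover have "card (cls ` lext u v) \<le> card (lext u v)"
      using finl by (intro card_image_le)
    \<comment> \<open>The non-palindromic edges come in reversed pairs, so \<open>card X\<close> is
      at most 2(l - 1); the unique palindromic extension raises this to 2l - 1, where l = r.\<close>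
    moreover have "card (bext u v) = card X + 1"
    proof -
      obtain z where z: "palindromic_extension u v z" using ext[OF v True] by blast
      have z_unique: "x = z" if "palindromic_extension u v x" for x
        using ext[OF v True] that z by blast
      have iff: "x \<in> bext u v \<and> palindrome x \<longleftrightarrow> x = z" for x
      proof
        assume "x \<in> bext u v \<and> palindrome x"
        then obtain a b where x: "x \<in> language u" "x = a # v @ [b]" "palindrome x"
          by (auto simp: bext_iff)
        then have "hd (rev (a # v @ [b])) = hd (a # v @ [b])" unfolding palindrome_def by metis
        then have "a = b" by simp
        then have "palindromic_extension u v x"
          using x(1) unfolding x(2) palindromic_extension_def by auto
        then show "x = z" by (rule z_unique)
      next
        assume "x = z"
        then obtain a where x: "x \<in> language u" "x = a # v @ [a]"
          using z by (auto simp: palindromic_extension_def)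
        then show "x \<in> bext u v \<and> palindrome x"
          using rv by (auto simp: bext_iff palindrome_def)
      qed
      have "bext u v = insert z X" "z \<notin> X"
        using iff unfolding X_def by blast+
      then show ?thesis using finl by simp
    qed
    ultimately show ?thesis using card_lr by simp
  qed
qed

text \<open>Summed over length \<open>n\<close>, both sides agree because the second difference of
  the complexity vanishes, so no single inequality can be strict.\<close>

lemma neutral_if_card_bext_le:
  assumes fin: "\<And>n. finite (factors u n)"
    and le: "\<And>v. v \<in> language u \<Longrightarrow> card (bext u v) + 1 \<le> card (lext u v) + card (rext u v)"
    and affine: "card (factors u (Suc (Suc n))) + card (factors u n) = 2 * card (factors u (Suc n))"
    and v: "v \<in> factors u n"
  shows "card (bext u v) + 1 = card (lext u v) + card (rext u v)"
proof (rule ccontr)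
  assume "\<not> ?thesis"
  then have "card (bext u v) + 1 < card (lext u v) + card (rext u v)"
    using le v by (metis language_factors factors_length le_neq_implies_less)
  then have "(\<Sum>v\<in>factors u n. card (bext u v) + 1)
      < (\<Sum>v\<in>factors u n. card (lext u v) + card (rext u v))"
    using fin v le by (intro sum_strict_mono_ex1) (auto simp: factors_def)
  moreover have "(\<Sum>v\<in>factors u n. card (bext u v) + 1)
      = card (factors u (Suc (Suc n))) + card (factors u n)"
    unfolding sum.distrib card_factors_bext[OF fin] by simp
  moreover have "(\<Sum>v\<in>factors u n. card (lext u v) + card (rext u v))
      = 2 * card (factors u (Suc n))"
    unfolding sum.distrib card_factors_lext[OF fin, symmetric] card_factors_rext[OF fin, symmetric]
    by simp
  ultimately show False using affine by simp
qed

section \<open>Recurrence and reversal\<close>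

text \<open>If \<open>w\<close> had a last occurrence, the prefix of \<open>u\<close> ending with it
  would occur again later and carry a later occurrence of \<open>w\<close>.\<close>

lemma occurrence_gt:
  assumes "recurrent u" "w \<in> language u"
  shows "\<exists>j>i. occurrence u w j"
proof (rule ccontr)
  assume none: "\<not> ?thesis"
  have fin: "finite {j. occurrence u w j}"
    by (rule finite_subset[of _ "{..i}"]) (use none not_less in auto)
  define m where "m = Max {j. occurrence u w j}"
  obtain i0 where "occurrence u w i0" using assms by (auto simp: recurrent_def)
  then have m: "occurrence u w m" using Max_in[OF fin] by (auto simp: m_def)
  define x where "x = u [0 \<rightarrow> 0 + (m + length w)]"
  have "x \<in> language u" unfolding x_def language_def by blast
  then obtain a b where "a \<noteq> b" "occurrence u x a" "occurrence u x b"
    using assms by (auto simp: recurrent_def)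
  then obtain a where a: "a > 0" "occurrence u x a" by (metis neq0_conv)
  have "occ_at w x m" unfolding x_def occ_at_subsequence using m by simp
  moreover have "u [a \<rightarrow> a + (m + length w)] = x"
    using a(2) by (simp add: occurrence_iff x_def)
  ultimately have "occurrence u w (a + m)" by (metis occ_at_subsequence)
  then have "a + m \<le> m" unfolding m_def using Max_ge[OF fin] by blast
  then show False using a by simp
qed

lemma uniformly_recurrent_occ_at:
  assumes ur: "uniformly_recurrent u" and w: "w \<in> language u"
  shows "\<exists>N. \<forall>n\<ge>N. \<forall>x\<in>factors u n. \<exists>p. occ_at w x p"
proof -
  have r: "recurrent u" using ur by (simp add: uniformly_recurrent_def)
  obtain B where B: "\<And>i j. successive_occurrences u w i j \<Longrightarrow> j - i \<le> B"
    using ur w unfolding uniformly_recurrent_def by blast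
  obtain i0 where i0: "occurrence u w i0" using occurrence_gt[OF r w] by blast
  \<comment> \<open>\<open>i0\<close> accounts for starting points up to a known occurrence,
    \<open>B\<close> for the gaps after it.\<close>
  have occ: "\<exists>j\<ge>i. j \<le> i + (i0 + B) \<and> occurrence u w j" for i
  proof (cases "i \<le> i0")
    case True
    then show ?thesis using i0 by (intro exI[of _ i0]) auto
  next
    case False
    \<comment> \<open>\<open>a\<close> is the last occurrence before \<open>i\<close> and
      \<open>b\<close> the next one, so \<open>b\<close> lies between \<open>i\<close> and
      \<open>a + B\<close>.\<close>
    define a where "a = Max {j. j < i \<and> occurrence u w j}"
    have fin: "finite {j. j < i \<and> occurrence u w j}" by simp
    have "i0 \<in> {j. j < i \<and> occurrence u w j}" using i0 False by simp
    then have "a \<in> {j. j < i \<and> occurrence u w j}"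
      unfolding a_def using Max_in[OF fin] by blast
    then have a: "a < i" "occurrence u w a" by simp_all
    have amax: "j \<le> a" if "j < i" "occurrence u w j" for j
      unfolding a_def using Max_ge[OF fin] that by blast
    define b where "b = (LEAST j. j > a \<and> occurrence u w j)"
    have b: "a < b \<and> occurrence u w b"
      unfolding b_def using occurrence_gt[OF r w] by (rule LeastI_ex)
    have "\<not> occurrence u w m" if "a < m" "m < b" for m
      using not_less_Least[of m "\<lambda>j. j > a \<and> occurrence u w j"] that by (auto simp: b_def)
    then have "b - a \<le> B"
      using a b by (intro B) (auto simp: successive_occurrences_def)
    moreover have "b \<ge> i" using amax b by (meson not_le)
    ultimately show ?thesis using a b by (intro exI[of _ b]) auto
  qed
  have "\<exists>p. occ_at w x p" if n: "n \<ge> i0 + B + length w" and x: "x \<in> factors u n" for n x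
  proof -
    obtain i where i: "x = u [i \<rightarrow> i + n]" using x by (auto simp: factors_eq_range)
    obtain j where j: "j \<ge> i" "j \<le> i + (i0 + B)" "occurrence u w j" using occ by blast
    have "occ_at w x (j - i)" unfolding i occ_at_subsequence using j n by auto
    then show ?thesis ..
  qed
  then show ?thesis by blast
qed

section \<open>Long palindromes, closure under reversal and the number of palindromes\<close>

lemma palindromes_nonempty:
  assumes "\<And>w. w \<in> language u \<Longrightarrow> palindrome w \<Longrightarrow> \<exists>v. palindromic_extension u w v"
  shows "palindromes u (2 * n) \<noteq> {}"
proof (induction n)
  case 0
  have "[] \<in> language u" by (auto simp: language_iff)
  then show ?case by (auto simp: palindromes_def factors_def palindrome_def)
next
  case (Suc n)
  then obtain w where w: "w \<in> language u" "palindrome w" "length w = 2 * n"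
    by (auto simp: palindromes_def factors_def)
  then obtain a where "a # w @ [a] \<in> language u"
    using assms by (force simp: palindromic_extension_def)
  then have "a # w @ [a] \<in> palindromes u (2 * Suc n)"
    using w by (simp add: palindromes_def factors_def palindrome_def)
  then show ?case by blast
qed

text \<open>By uniform recurrence a long palindrome contains \<open>w\<close>; read backwards, it
  contains \<open>rev w\<close>.\<close>

lemma rev_in_language:
  assumes ur: "uniformly_recurrent u"
    and ext: "\<And>w. w \<in> language u \<Longrightarrow> palindrome w \<Longrightarrow> \<exists>v. palindromic_extension u w v"
    and w: "w \<in> language u"
  shows "rev w \<in> language u"
proof -
  obtain N where N: "\<And>n x. n \<ge> N \<Longrightarrow> x \<in> factors u n \<Longrightarrow> \<exists>p. occ_at w x p"
    using uniformly_recurrent_occ_at[OF ur w] by blast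
  \<comment> \<open>The length is even because the palindromes are grown from the empty
    word.\<close>
  obtain x where x: "x \<in> factors u (2 * N)" "palindrome x"
    using palindromes_nonempty[OF ext, of N] by (auto simp: palindromes_def)
  obtain p where p: "take (length w) (drop p x) = w"
    using N[OF _ x(1)] by (auto simp: occ_at_def)
  define y where "y = drop p x"
  have "rev y = take (length x - p) x"
    using x(2) by (metis y_def palindrome_def rev_drop)
  then have "rev y \<in> language u" using x(1) by (simp add: take_in_language factors_def)
  moreover have "rev w = drop (length y - length w) (rev y)"
    using p by (metis rev_take y_def)
  ultimately show ?thesis by (simp add: drop_in_language)
qed

text \<open>Stripping both outer letters is a bijection: existence of the extension gives
  surjectivity, uniqueness gives injectivity.\<close>

lemma card_palindromes_Suc_Suc:
  assumes fin: "\<And>n. finite (factors u n)"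
    and ext: "\<And>w. w \<in> language u \<Longrightarrow> palindrome w \<Longrightarrow> \<exists>!v. palindromic_extension u w v"
  shows "card (palindromes u (Suc (Suc n))) = card (palindromes u n)"
proof -
  have core: "butlast (tl x) \<in> palindromes u n \<and> palindromic_extension u (butlast (tl x)) x"
    if x: "x \<in> palindromes u (Suc (Suc n))" for x
  proof -
    define v where "v = butlast (tl x)"
    have xf: "x \<in> factors u (Suc (Suc n))" "palindrome x" using x by (auto simp: palindromes_def)
    have v: "v \<in> factors u n"
      unfolding v_def using xf by (intro butlast_in_factors tl_in_factors)
    have "x \<in> bext u v" using xf v by (auto simp: bext_def v_def factors_def)
    then obtain a b where ab: "x = a # v @ [b]" "x \<in> language u" by (auto simp: bext_iff)
    then have "rev (a # v @ [b]) = a # v @ [b]" using xf(2) unfolding palindrome_def by metis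
    moreover from this have "b = a" by (metis hd_rev last_snoc list.sel(1) append_Cons)
    ultimately have "x = [a] @ v @ [a]" "rev v = v" using ab(1) by simp_all
    then show ?thesis
      using ab(2) v unfolding v_def[symmetric] palindromes_def palindrome_def
        palindromic_extension_def by blast
  qed
  have "bij_betw (\<lambda>x. butlast (tl x)) (palindromes u (Suc (Suc n))) (palindromes u n)"
  proof (rule bij_betw_imageI)
    show "inj_on (\<lambda>x. butlast (tl x)) (palindromes u (Suc (Suc n)))"
    proof (rule inj_onI)
      fix x y assume x: "x \<in> palindromes u (Suc (Suc n))" and y: "y \<in> palindromes u (Suc (Suc n))"
        and eq: "butlast (tl x) = butlast (tl y)"
      have "butlast (tl x) \<in> language u" "palindrome (butlast (tl x))"
        using core[OF x] by (auto simp: palindromes_def factors_def)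
      then show "x = y" using ext core[OF x] core[OF y] eq by metis
    qed
    show "(\<lambda>x. butlast (tl x)) ` palindromes u (Suc (Suc n)) = palindromes u n"
    proof (intro subset_antisym subsetI)
      fix v assume "v \<in> palindromes u n"
      then have v: "v \<in> language u" "palindrome v" "length v = n"
        by (auto simp: palindromes_def factors_def)
      then obtain a where a: "a # v @ [a] \<in> language u"
        using ext[OF v(1,2)] by (force simp: palindromic_extension_def)
      then have "a # v @ [a] \<in> palindromes u (Suc (Suc n))"
        using v by (simp add: palindromes_def factors_def palindrome_def)
      moreover have "v = butlast (tl (a # v @ [a]))" by simp
      ultimately show "v \<in> (\<lambda>x. butlast (tl x)) ` palindromes u (Suc (Suc n))" by blast
    qed (use core in auto)
  qed
  then show ?thesis by (rule bij_betw_same_card)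
qed

lemma palindromes_0: "palindromes u 0 = {[]}"
  by (auto simp: palindromes_def factors_eq_range palindrome_def)

lemma palindromes_1: "palindromes u (Suc 0) = (\<lambda>a. [a]) ` range u"
  by (auto simp: palindromes_def factors_eq_range palindrome_def)

text \<open>The counts have period two, starting with the empty word and the letters.\<close>

lemma card_palindromes_sum:
  assumes "\<And>n. finite (factors u n)"
    and "\<And>w. w \<in> language u \<Longrightarrow> palindrome w \<Longrightarrow> \<exists>!v. palindromic_extension u w v"
  shows "card (palindromes u n) + card (palindromes u (Suc n)) = card (range u) + 1"
proof (induction n)
  case 0
  have "card ((\<lambda>a. [a]) ` range u) = card (range u)"
    by (rule card_image) (simp add: inj_on_def)
  then show ?case by (simp add: palindromes_0 palindromes_1)
next
  case (Suc n)
  then show ?case by (simp add: card_palindromes_Suc_Suc[OF assms])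
qed

theorem corollary24:
  fixes A :: "'a set" and u :: "'a word" and k :: nat
  assumes "infinite_word_over A u"
    and "card A = k"
    and "uniformly_recurrent u"
    and "\<And>n. factor_complexity u n = (k - 1) * n + 1"
    and "\<And>w. w \<in> language u \<Longrightarrow> palindrome w \<Longrightarrow> \<exists>!v. palindromic_extension u w v"
  shows "\<forall>w \<in> language u. card (return_words u w) = k"
proof
  fix w assume w: "w \<in> language u"
  have card_f: "card (factors u n) = (k - 1) * n + 1" for n
    using assms(4) by (simp add: factor_complexity_def factors_def)
  \<comment> \<open>An infinite set would have \<open>card\<close> 0, but the complexity is
    positive.\<close>
  have fin: "finite (factors u n)" for n
    using card_f[of n] by (intro card_ge_0_finite) simp
  have A: "finite A" "range u = A" using assms(1) by (simp_all add: infinite_word_over_def)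
  \<comment> \<open>Makes the truncated \<open>k - 1\<close> a true difference.\<close>
  have "k > 0" using A assms(2) by (auto simp: card_gt_0_iff)
  have ext: "\<exists>v. palindromic_extension u w v" if "w \<in> language u" "palindrome w" for w
    using assms(5)[OF that] by blast
  have rev: "rev w \<in> language u" if "w \<in> language u" for w
    using assms(3) ext that by (rule rev_in_language)
  \<comment> \<open>The palindromes contribute k + 1 and the complexity grows by k - 1: exactly the
    tree condition.\<close>
  have pal: "card (palindromes u n) + card (palindromes u (Suc n)) + card (factors u n)
      = card (factors u (Suc n)) + 2" for n
    using card_palindromes_sum[OF fin assms(5), of n] \<open>k > 0\<close> A(2) assms(2)
    by (simp add: card_f)
  have le: "card (bext u v) + 1 \<le> card (lext u v) + card (rext u v)" if "v \<in> language u" for v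
    using fin rev pal assms(5) that by (rule card_bext_le)
  have "card (bext u v) + 1 = card (lext u v) + card (rext u v)" if "v \<in> language u" for v
  proof (rule neutral_if_card_bext_le[OF fin le])
    show "v \<in> factors u (length v)" using that by (simp add: factors_def)
  qed (simp_all add: card_f)
  then have neutral: "\<forall>v\<in>language u. card (bext u v) + 1 = card (lext u v) + card (rext u v)"
    by blast
  obtain N where N: "\<forall>x\<in>factors u N. \<exists>p. occ_at w x p"
    using uniformly_recurrent_occ_at[OF assms(3) w] by blast
  have "int (card (return_words u w)) = 1 + int (card (factors u (Suc N))) - int (card (factors u N))"
    using fin neutral N w by (rule card_return_words_neutral)
  also have "\<dots> = int k" using \<open>k > 0\<close> by (simp add: card_f)
  finally show "card (return_words u w) = k" by simp
qed

end
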